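(* Let $X$ be a separable Banach space over $\mathbb{K}$ ($\mathbb{R}$ or $\mathbb{C}$), let $x_m^*\in X^*$ for all $m\in\mathbb{N}$, and let $\epsilon>0$. Assume that $(\tilde e_n)_{n=1}^\infty$ is a Schauder basis of $X$ which is shrinking with respect to $x_m^*$ for every $m\in\mathbb{N}$. Then there exist an increasing sequence $(n_m)_{m=1}^\infty\subset\mathbb{N}$ and a Schauder basis $(e_n)_{n=1}^\infty$ of $X$ such that, for every $m\in\mathbb{N}$, $$x_m^*(e_n)=0\quad\text{for all } n\geq n_m,$$ and such that the linear operator $T:X\to X$ with $T\tilde e_n=e_n$ for all $n\in\mathbb{N}$ satisfies $$\|\mathrm{id}_X-T\|<\epsilon .$$
   Context: $X^*$ is the dual space (bounded linear functionals). A sequence $(\tilde e_n)_{n=1}^\infty$ in $X$ is a Schauder basis if every $f\in X$ can be written as a norm-convergent series $f=\sum_{n=1}^\infty f_n\tilde e_n$ with uniquely determined scalars $f_n$. Its basis projections are $P_n f=\sum_{k=1}^n f_k\tilde e_k$, $n\in\mathbb{N}$. Given $x^*\in X^*$, the Schauder basis $(\tilde e_n)_{n=1}^\infty$ is called shrinking with respect to $x^*$ if $$\lim_{n\to\infty}\|x^*\circ(\mathrm{id}_X-P_n)\|_{X^*}=0 .$$ $\|\mathrm{id}_X-T\|$ is the operator norm. *)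

theory Defs
  imports "HOL-Analysis.Analysis"
begin

text \<open>
  The scalar field \<open>'k\<close> is a complete commutative real normed field with multiplicative norm;
  both \<^typ>\<open>real\<close> and \<^typ>\<open>complex\<close> are instances, and by the Gelfand-Mazur
  theorem there are no others up to isometric isomorphism. A Banach space over \<open>'k\<close> is a type
  of class \<^class>\<open>banach\<close> with a scalar multiplication by \<open>'k\<close> that extends the
  real one and for which the given norm is homogeneous.
\<close>

locale normed_space_over = vector_space smul
  for smul :: "'k::real_normed_field \<Rightarrow> 'x::real_normed_vector \<Rightarrow> 'x" +
  assumes smul_of_real: "smul (of_real r) x = r *\<^sub>R x"
    and norm_smul: "norm (smul a x) = norm a * norm x"

lemma normed_space_over_scaleR:
  "normed_space_over (scaleR :: real \<Rightarrow> 'x::real_normed_vector \<Rightarrow> 'x)"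
  by unfold_locales (simp_all add: algebra_simps)

lemma normed_space_over_mult:
  "normed_space_over ((*) :: 'k \<Rightarrow> 'k \<Rightarrow> 'k::real_normed_field)"
  by unfold_locales (simp_all add: algebra_simps norm_mult scaleR_conv_of_real)

text \<open>
  \<^const>\<open>bounded_linear\<close> alone only gives linearity over the reals; linearity over
  \<open>'k\<close> is required in addition.
\<close>

definition bounded_linear_over ::
  "('k::field \<Rightarrow> 'x \<Rightarrow> 'x) \<Rightarrow> ('k \<Rightarrow> 'y \<Rightarrow> 'y) \<Rightarrow>
    ('x::real_normed_vector \<Rightarrow> 'y::real_normed_vector) \<Rightarrow> bool" where
  "bounded_linear_over smul1 smul2 T \<longleftrightarrow>
    Vector_Spaces.linear smul1 smul2 T \<and> bounded_linear T"

definition dual_space :: "('k::real_normed_field \<Rightarrow> 'x \<Rightarrow> 'x) \<Rightarrow> ('x::real_normed_vector \<Rightarrow> 'k) set" where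
  "dual_space smul = {\<phi>. bounded_linear_over smul (*) \<phi>}"

text \<open>
  Sequences are indexed from \<open>0\<close>: \<open>e k\<close> is the basis vector usually numbered
  \<open>k + 1\<close>. The \<open>n\<close>-th partial sum thus ranges over \<open>k < n\<close>.
\<close>

definition schauder_basis ::
  "('k \<Rightarrow> 'x \<Rightarrow> 'x) \<Rightarrow> (nat \<Rightarrow> 'x::real_normed_vector) \<Rightarrow> bool" where
  "schauder_basis smul e \<longleftrightarrow>
    (\<forall>f. \<exists>!c :: nat \<Rightarrow> 'k. (\<lambda>n. smul (c n) (e n)) sums f)"

definition basis_coeffs ::
  "('k \<Rightarrow> 'x \<Rightarrow> 'x) \<Rightarrow> (nat \<Rightarrow> 'x::real_normed_vector) \<Rightarrow> 'x \<Rightarrow> nat \<Rightarrow> 'k" where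
  "basis_coeffs smul e f = (THE c. (\<lambda>n. smul (c n) (e n)) sums f)"

definition basis_projection ::
  "('k \<Rightarrow> 'x \<Rightarrow> 'x) \<Rightarrow> (nat \<Rightarrow> 'x::real_normed_vector) \<Rightarrow> nat \<Rightarrow> 'x \<Rightarrow> 'x" where
  "basis_projection smul e n f = (\<Sum>k<n. smul (basis_coeffs smul e f k) (e k))"

text \<open>
  The projections of a Schauder basis of a Banach space are bounded, so \<^const>\<open>onorm\<close>
  below is the genuine dual norm.
\<close>

definition shrinking_wrt ::
  "('k::real_normed_field \<Rightarrow> 'x \<Rightarrow> 'x) \<Rightarrow> (nat \<Rightarrow> 'x::real_normed_vector) \<Rightarrow> ('x \<Rightarrow> 'k) \<Rightarrow> bool" where
  "shrinking_wrt smul e \<phi> \<longleftrightarrow>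
    (\<lambda>n. onorm (\<phi> \<circ> (\<lambda>f. f - basis_projection smul e n f))) \<longlonglongrightarrow> 0"

end

theory Submission
  imports Defs
begin

text \<open>
  Choose \<open>y m\<close> in the common kernel of \<open>xs k\<close>, \<open>k < m\<close>, with \<open>xs m (y m) = 1\<close> if
  such a vector exists. Put \<open>R 0 = id\<close> and let \<open>R (m+1)\<close> arise from \<open>R m\<close> by subtracting the
  rank-one operator \<open>f \<mapsto> xs m (R m (f - P (N m) f)) \<cdot> y m\<close>, where shrinking makes its norm
  as small as we like for large \<open>N m\<close>. Then \<open>xs m \<circ> R (m+1) = xs m \<circ> R m \<circ> P (N m)\<close>, which
  vanishes on the basis vectors from \<open>N m\<close> on, and the later corrections do not affect
  \<open>xs m\<close>. Hence \<open>T = lim R m\<close> has the required zeros, and since \<open>\<parallel>id - T\<parallel> < 1\<close> it is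
  invertible and maps the basis to a basis. If no \<open>y m\<close> with \<open>xs m (y m) = 1\<close> exists, then
  \<open>xs m\<close> vanishes on the common kernel of its predecessors and inherits their zeros.
\<close>

section \<open>Scalar multiplication as a bounded bilinear map\<close>

context normed_space_over
begin

lemma bounded_bilinear_smul: "bounded_bilinear smul"
proof (rule bounded_bilinear.intro)
  show "smul (r *\<^sub>R a) b = r *\<^sub>R smul a b" for r a b
    by (simp add: scaleR_conv_of_real smul_of_real flip: scale_scale)
  show "smul a (r *\<^sub>R b) = r *\<^sub>R smul a b" for r a b
    by (simp add: scale_left_commute flip: smul_of_real)
  show "\<exists>K. \<forall>a b. norm (smul a b) \<le> norm a * norm b * K"
    by (rule exI[of _ 1]) (simp add: norm_smul)
qed (simp_all add: scale_left_distrib scale_right_distrib)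

lemmas bounded_linear_smul_right = bounded_bilinear.bounded_linear_right[OF bounded_bilinear_smul]
lemmas bounded_linear_smul_left = bounded_bilinear.bounded_linear_left[OF bounded_bilinear_smul]

text \<open>Additivity is already part of real linearity, so only homogeneity over the scalar field
  remains to be checked.\<close>

lemma bounded_linear_over_iff:
  assumes "normed_space_over smul'"
  shows "bounded_linear_over smul smul' T \<longleftrightarrow>
    bounded_linear T \<and> (\<forall>a x. T (smul a x) = smul' a (T x))"
proof -
  interpret Y: normed_space_over smul' by fact
  show ?thesis
    unfolding bounded_linear_over_def Vector_Spaces.linear_iff
    using vector_space_axioms Y.vector_space_axioms
    by (auto simp: real_vector.linear_add dest: bounded_linear.linear)
qed

end

section \<open>Algebra of basis coefficients and basis projections\<close>

locale schauder_basis_space = normed_space_over smul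
  for smul :: "'k::{real_normed_field,banach} \<Rightarrow> 'x::banach \<Rightarrow> 'x" +
  fixes e :: "nat \<Rightarrow> 'x"
  assumes basis: "schauder_basis smul e"
begin

abbreviation "coef \<equiv> basis_coeffs smul e"
abbreviation "P \<equiv> basis_projection smul e"

lemma sums_coef: "(\<lambda>n. smul (coef f n) (e n)) sums f"
proof -
  have "\<exists>!c. (\<lambda>n. smul (c n) (e n)) sums f"
    using basis by (simp add: schauder_basis_def)
  then show ?thesis
    unfolding basis_coeffs_def by (rule theI')
qed

lemma coef_eqI: "(\<lambda>n. smul (c n) (e n)) sums f \<Longrightarrow> coef f = c"
  using basis sums_coef[of f] unfolding schauder_basis_def by blast

lemma coef_add: "coef (f + g) = (\<lambda>n. coef f n + coef g n)"
  using sums_add[OF sums_coef[of f] sums_coef[of g]]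
  by (intro coef_eqI) (simp add: scale_left_distrib)

lemma coef_smul: "coef (smul a f) = (\<lambda>n. a * coef f n)"
  using bounded_linear.sums[OF bounded_linear_smul_right[of a] sums_coef[of f]]
  by (intro coef_eqI) simp

lemma coef_finite_sum:
  "coef (\<Sum>k<n. smul (c k) (e k)) = (\<lambda>k. if k < n then c k else 0)"
proof (rule coef_eqI)
  show "(\<lambda>k. smul (if k < n then c k else 0) (e k)) sums (\<Sum>k<n. smul (c k) (e k))"
    using sums_finite[of "{..<n}" "\<lambda>k. smul (if k < n then c k else 0) (e k)"] by simp
qed

text \<open>A zero basis vector could carry any coefficient, so 0 would have two expansions. This
  permits division by \<open>norm (e n)\<close> in coefficient estimates.\<close>

lemma basis_nonzero: "e k \<noteq> 0"
proof
  assume "e k = 0"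
  then have "(\<lambda>i. smul (if i = k then 1 else 0) (e i)) = (\<lambda>i. 0)"
    by auto
  then have "coef 0 = (\<lambda>i. if i = k then 1 else 0)"
    by (intro coef_eqI) simp
  moreover have "coef 0 = (\<lambda>i. 0)"
    by (intro coef_eqI) simp
  ultimately have "(\<lambda>i. if i = k then 1 else 0) = (\<lambda>i. 0 :: 'k)"
    by (rule trans[OF sym])
  from fun_cong[OF this, of k] show False by simp
qed

lemma projection_add: "P n (f + g) = P n f + P n g"
  by (simp add: basis_projection_def coef_add scale_left_distrib sum.distrib)

lemma projection_smul: "P n (smul a f) = smul a (P n f)"
  by (simp add: basis_projection_def coef_smul scale_sum_right)

lemma projection_scaleR: "P n (r *\<^sub>R f) = r *\<^sub>R P n f"
  using projection_smul[of n "of_real r" f] by (simp add: smul_of_real)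

lemma projection_linear: "linear (P n)"
  by (rule linearI) (simp_all add: projection_add projection_scaleR)

lemmas projection_diff = linear_diff[OF projection_linear]

lemma projection_tendsto: "(\<lambda>n. P n f) \<longlonglongrightarrow> f"
  using sums_coef[of f] by (simp add: sums_def basis_projection_def)

lemma projection_basis: "P n (e k) = (if k < n then e k else 0)"
proof -
  have "coef (e k) = (\<lambda>i. if i = k then 1 else 0)"
  proof (rule coef_eqI)
    have "(\<lambda>i. smul (if i = k then 1 else 0) (e i)) = (\<lambda>i. if i = k then e i else 0)"
      by auto
    then show "(\<lambda>i. smul (if i = k then 1 else 0) (e i)) sums e k"
      using sums_single[of k e] by simp
  qed
  then have "P n (e k) = (\<Sum>i<n. if i = k then e i else 0)"
    unfolding basis_projection_def by (intro sum.cong) simp_all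
  then show ?thesis by simp
qed

lemma projection_projection: "P m (P n f) = P (min m n) f"
proof -
  have "P m (P n f) = (\<Sum>k<m. if k < n then smul (coef f k) (e k) else 0)"
    unfolding basis_projection_def coef_finite_sum
    by (rule sum.cong) auto
  also have "\<dots> = (\<Sum>k\<in>{..<m} \<inter> {..<n}. smul (coef f k) (e k))"
    by (simp add: sum.If_cases lessThan_def)
  also have "{..<m} \<inter> {..<n} = {..<min m n}" by auto
  finally show ?thesis by (simp add: basis_projection_def)
qed

lemma projection_Suc_diff: "P (Suc n) f - P n f = smul (coef f n) (e n)"
  by (simp add: basis_projection_def)

section \<open>Uniform boundedness of the basis projections\<close>

text \<open>
  The first half of the open mapping argument, for the norm \<open>sup n. \<parallel>P n f\<parallel>\<close>: by Baire, the
  closure of one of its balls contains a ball of the given norm.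
\<close>

lemma projection_approx:
  "\<exists>L\<ge>0. \<forall>f. \<exists>g. norm (f - g) \<le> norm f / 2 \<and> (\<forall>n. norm (P n g) \<le> L * norm f)"
proof -
  define A where "A M = {f. \<forall>n. norm (P n f) \<le> real M}" for M :: nat
  have "f \<in> (\<Union>M. A M)" for f
  proof -
    have "Bseq (\<lambda>n. P n f)"
      using projection_tendsto convergent_imp_Bseq convergent_def by blast
    then obtain K where K: "norm (P n f) \<le> K" for n
      by (auto simp: Bseq_def)
    have "norm (P n f) \<le> real (nat \<lceil>K\<rceil>)" for n
      using order_trans[OF K real_nat_ceiling_ge] .
    then show ?thesis by (auto simp: A_def)
  qed
  then have cover: "\<Union>(range (\<lambda>M. closure (A M))) = UNIV"
    using closure_subset by fastforce
  have "\<exists>M. interior (closure (A M)) \<noteq> {}"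
  proof (rule ccontr)
    assume "\<not> ?thesis"
    then have "euclidean interior_of \<Union>(range (\<lambda>M. closure (A M))) = {}"
      by (intro Baire_category_alt) (auto simp: completely_metrizable_space_euclidean)
    then show False
      unfolding cover by simp
  qed
  then obtain M x r where r: "r > 0" "ball x r \<subseteq> closure (A M)"
    by (metis all_not_in_conv mem_interior)
  \<comment> \<open>A difference of two elements of \<open>A M\<close> has projections of norm at
    most \<open>2 * M\<close>; undoing the scaling by \<open>t\<close> below multiplies this by
    \<open>2 * norm f / r\<close>.\<close>
  define L where "L = 4 * real M / r"
  have "\<exists>g. norm (f - g) \<le> norm f / 2 \<and> (\<forall>n. norm (P n g) \<le> L * norm f)" for f
  proof (cases "f = 0")
    case True
    then show ?thesis
      by (intro exI[of _ 0]) (auto simp: linear_0[OF projection_linear])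
  next
    case False
    define t where "t = r / (2 * norm f)"
    have t: "t > 0" "t * norm f = r / 2"
      using False r by (auto simp: t_def)
    have "x + t *\<^sub>R f \<in> closure (A M)" "x \<in> closure (A M)"
      using r t by (auto intro!: subsetD[OF r(2)] simp: dist_norm)
    \<comment> \<open>Two errors of \<open>r / 8\<close> add up to
      \<open>r / 4 = t * (norm f / 2)\<close>, which is the halving wanted for
      \<open>f - g\<close>.\<close>
    moreover have "r / 8 > 0" using r by simp
    ultimately obtain u v where uv: "u \<in> A M" "v \<in> A M"
      "dist u (x + t *\<^sub>R f) < r / 8" "dist v x < r / 8"
      unfolding closure_approachable by metis
    define g where "g = (1 / t) *\<^sub>R (u - v)"
    have tg: "t *\<^sub>R g = u - v" using t by (simp add: g_def)
    have "t * norm (f - g) = norm (t *\<^sub>R (f - g))" using t by simp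
    also have "t *\<^sub>R (f - g) = (x + t *\<^sub>R f - u) - (x - v)"
      by (simp add: algebra_simps tg)
    also have "norm \<dots> \<le> r / 8 + r / 8"
      using uv by (intro order_trans[OF norm_triangle_ineq4]) (auto simp: dist_norm norm_minus_commute)
    also have "\<dots> = t * (norm f / 2)" using t by simp
    finally have 1: "norm (f - g) \<le> norm f / 2"
      by (rule mult_left_le_imp_le[OF _ t(1)])
    have "norm (P n g) \<le> L * norm f" for n
    proof -
      have "t * norm (P n g) = norm (P n (t *\<^sub>R g))" using t by (simp add: projection_scaleR)
      also have "\<dots> \<le> real M + real M"
        unfolding tg projection_diff using uv
        by (intro order_trans[OF norm_triangle_ineq4] add_mono) (auto simp: A_def)
      also have "\<dots> = t * (L * norm f)"
        using t r by (simp add: L_def) (simp add: field_simps)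
      finally show ?thesis by (rule mult_left_le_imp_le[OF _ t(1)])
    qed
    with 1 show ?thesis by blast
  qed
  moreover have "L \<ge> 0" using r by (simp add: L_def)
  ultimately show ?thesis by blast
qed

text \<open>The second half of the open mapping argument. Iterated approximation writes
  \<open>f\<close> as a series whose terms have projections dominated by a geometric series. Summing
  these projections for each \<open>n\<close> gives the partial sums of an expansion of
  \<open>f\<close>, which uniqueness identifies with \<open>P n f\<close>.\<close>

lemma projection_uniformly_bounded: "\<exists>K\<ge>0. \<forall>n f. norm (P n f) \<le> K * norm f"
proof -
  obtain L where L: "L \<ge> 0"
    and ex: "\<And>f. \<exists>g. norm (f - g) \<le> norm f / 2 \<and> (\<forall>n. norm (P n g) \<le> L * norm f)"
    using projection_approx by blast
  from ex obtain G where G: "\<And>f. norm (f - G f) \<le> norm f / 2"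
    "\<And>f n. norm (P n (G f)) \<le> L * norm f"
    by metis
  have "norm (P n f) \<le> 2 * L * norm f" for n f
  proof -
    \<comment> \<open>The remainder after \<open>j\<close> approximations; its norm is at least
      halved each time.\<close>
    define h where "h j = ((\<lambda>u. u - G u) ^^ j) f" for j
    have h_Suc: "h (Suc j) = h j - G (h j)" and h_0: "h 0 = f" for j
      by (simp_all add: h_def)
    have h_norm: "norm (h j) \<le> norm f * (1/2)^j" for j
    proof (induction j)
      case (Suc j)
      then show ?case using G(1)[of "h j"] by (simp add: h_Suc)
    qed (simp add: h_0)
    define M where "M j = L * (norm f * (1/2)^j)" for j :: nat
    have M: "M sums (L * (norm f * 2))"
      unfolding M_def using geometric_sums[of "1/2::real"] by (intro sums_mult) simp
    have PM: "norm (P n (G (h j))) \<le> M j" for n j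
      using order_trans[OF G(2) mult_left_mono[OF h_norm L]] by (simp add: M_def)
    have telescope: "(\<Sum>j<J. G (h j)) = f - h J" for J
      by (induction J) (simp_all add: h_0 h_Suc)
    have "(\<lambda>j. norm f * (1/2)^j) \<longlonglongrightarrow> 0"
      by (intro tendsto_mult_right_zero LIMSEQ_realpow_zero) auto
    then have "h \<longlonglongrightarrow> 0"
      by (rule Lim_null_comparison[rotated]) (simp add: h_norm)
    then have G_lim: "(\<lambda>J. \<Sum>j<J. G (h j)) \<longlonglongrightarrow> f"
      unfolding telescope using tendsto_diff[OF tendsto_const, of h 0 sequentially f] by simp
    define s where "s n = (\<Sum>j. P n (G (h j)))" for n
    have unif: "uniform_limit UNIV (\<lambda>J n. \<Sum>j<J. P n (G (h j))) s sequentially"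
      unfolding s_def using PM sums_summable[OF M] by (intro Weierstrass_m_test) auto
    \<comment> \<open>Uniformity in \<open>n\<close> is what identifies \<open>s n\<close> with \<open>P n f\<close>, although \<open>P n\<close> is not
      yet known to be continuous.\<close>
    have s_lim: "s \<longlonglongrightarrow> f"
    proof (rule swap_uniform_limit'[OF _ G_lim unif])
      show "\<forall>\<^sub>F J in sequentially. (\<lambda>n. \<Sum>j<J. P n (G (h j))) \<longlonglongrightarrow> (\<Sum>j<J. G (h j))"
        by (intro always_eventually allI tendsto_sum projection_tendsto)
    qed auto
    have s_sums: "(\<lambda>j. P n (G (h j))) sums s n" for n
      unfolding s_def
      by (rule summable_sums[OF summable_comparison_test'[OF sums_summable[OF M] PM]])
    \<comment> \<open>Each term of the series for this increment is a multiple of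
      \<open>e n\<close>, and the scalar factors are absolutely summable; completeness of the scalar
      field then supplies \<open>c\<close>.\<close>
    have "\<exists>c. s (Suc n) - s n = smul c (e n)" for n
    proof -
      have d: "(\<lambda>j. smul (coef (G (h j)) n) (e n)) sums (s (Suc n) - s n)"
        using sums_diff[OF s_sums[of "Suc n"] s_sums[of n]] by (simp add: projection_Suc_diff)
      have coef_le: "norm (coef (G (h j)) n) \<le> 2 * M j / norm (e n)" for j
      proof -
        have "norm (coef (G (h j)) n) * norm (e n) = norm (P (Suc n) (G (h j)) - P n (G (h j)))"
          by (simp add: projection_Suc_diff norm_smul)
        also have "\<dots> \<le> M j + M j"
          by (intro order_trans[OF norm_triangle_ineq4] add_mono PM)
        finally show ?thesis using basis_nonzero by (simp add: field_simps)
      qed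
      have "summable (\<lambda>j. 2 * M j / norm (e n))"
        using sums_summable[OF M] by (intro summable_divide summable_mult)
      then have "summable (\<lambda>j. coef (G (h j)) n)"
        using coef_le by (rule summable_comparison_test')
      then have "(\<lambda>j. smul (coef (G (h j)) n) (e n)) sums smul (\<Sum>j. coef (G (h j)) n) (e n)"
        by (intro bounded_linear.sums[OF bounded_linear_smul_left] summable_sums)
      with d show ?thesis using sums_unique2 by blast
    qed
    then obtain c where c: "s (Suc n) - s n = smul (c n) (e n)" for n by metis
    have "s 0 = 0" by (simp add: s_def basis_projection_def)
    then have s_eq: "s n = (\<Sum>k<n. smul (c k) (e k))" for n
      by (induction n) (simp_all flip: c)
    with s_lim have "coef f = c"
      by (intro coef_eqI) (simp add: sums_def flip: s_eq)
    then have "P n f = s n"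
      by (simp add: basis_projection_def s_eq)
    also have "norm (s n) \<le> (\<Sum>j. M j)"
      unfolding s_def using PM sums_summable[OF M] by (intro norm_suminf_le) auto
    also have "\<dots> = 2 * L * norm f"
      using sums_unique[OF M] by simp
    finally show ?thesis .
  qed
  with L show ?thesis by (intro exI[of _ "2 * L"]) auto
qed

lemma projection_bounded_linear: "bounded_linear (P n)"
proof -
  obtain K where "\<And>n f. norm (P n f) \<le> K * norm f"
    using projection_uniformly_bounded by blast
  then show ?thesis
    by (intro bounded_linear_intro[of _ K]) (simp_all add: projection_add projection_scaleR mult.commute)
qed

lemma bounded_linear_projection_compl: "bounded_linear (\<lambda>f. f - P n f)"
  by (intro bounded_linear_sub bounded_linear_ident projection_bounded_linear)

lemma bounded_linear_comp_projection_compl: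
  assumes "bounded_linear \<phi>" "bounded_linear R"
  shows "bounded_linear ((\<phi> \<circ> R) \<circ> (\<lambda>f. f - P n f))"
  using bounded_linear_compose[OF assms(1) bounded_linear_compose[OF assms(2)
      bounded_linear_projection_compl[of n]]]
  by (simp add: comp_def)

end

section \<open>Isomorphisms close to the identity and images of bases\<close>

text \<open>Solving \<open>T x = y\<close> means finding a fixed point of the contraction sending
  \<open>x\<close> to \<open>y + (x - T x)\<close>. The estimate
  \<open>(1 - c) * norm x \<le> norm (T x)\<close> gives injectivity and bounds the inverse.\<close>

lemma onorm_less_1_bij:
  fixes T :: "'x::banach \<Rightarrow> 'x"
  assumes T: "bounded_linear T" and lt: "onorm (\<lambda>x. x - T x) < 1"
  shows "\<exists>S. bounded_linear S \<and> (\<forall>x. S (T x) = x) \<and> (\<forall>x. T (S x) = x)"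
proof -
  interpret T: bounded_linear T by fact
  define c where "c = onorm (\<lambda>x. x - T x)"
  have D: "bounded_linear (\<lambda>x. x - T x)"
    by (intro bounded_linear_sub bounded_linear_ident T)
  have c: "0 \<le> c" "c < 1" "norm (x - T x) \<le> c * norm x" for x
    using lt onorm_pos_le[OF D] onorm[OF D] by (auto simp: c_def)
  have lower: "(1 - c) * norm x \<le> norm (T x)" for x
    using c(3)[of x] norm_triangle_ineq2[of x "T x"] by (simp add: algebra_simps)
  have inj: "x = y" if "T x = T y" for x y
    using lower[of "x - y"] that c(2) by (simp add: T.diff mult_le_0_iff)
  have "\<exists>x. T x = y" for y
  proof -
    have "\<exists>!x. y + (x - T x) = x"
    proof (rule banach_fix_type[OF c(1,2)], intro allI)
      fix u v
      have "dist (y + (u - T u)) (y + (v - T v)) = norm ((u - v) - T (u - v))"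
        by (simp add: dist_norm T.diff algebra_simps)
      then show "dist (y + (u - T u)) (y + (v - T v)) \<le> c * dist u v"
        using c(3) by (simp add: dist_norm)
    qed
    then obtain x where "y + (x - T x) = x" by blast
    then show ?thesis by (intro exI[of _ x]) (simp add: algebra_simps)
  qed
  then obtain S where S: "T (S y) = y" for y by metis
  have "bounded_linear S"
  proof (rule bounded_linear_intro)
    show "S (x + y) = S x + S y" "S (r *\<^sub>R x) = r *\<^sub>R S x" for x y r
      by (rule inj, simp add: S T.add T.scaleR)+
    show "norm (S x) \<le> norm x * (1 / (1 - c))" for x
      using lower[of "S x"] c(2) by (simp add: S field_simps)
  qed
  with S inj show ?thesis by blast
qed

text \<open>\<open>S\<close> and \<open>T\<close> carry expansions along the two sequences into each
  other with the same coefficients, so existence and uniqueness transfer.\<close>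

lemma (in normed_space_over) schauder_basis_image:
  assumes e: "schauder_basis smul e"
    and T: "bounded_linear T" "\<And>a x. T (smul a x) = smul a (T x)"
    and S: "bounded_linear S" "\<And>x. S (T x) = x" "\<And>x. T (S x) = x"
  shows "schauder_basis smul (\<lambda>n. T (e n))"
proof -
  have S_smul: "S (smul a x) = smul a (S x)" for a x
    using S(2)[of "smul a (S x)"] by (simp add: T(2) S(3))
  have "(\<lambda>n. smul (c n) (T (e n))) sums f \<longleftrightarrow> (\<lambda>n. smul (c n) (e n)) sums S f" for c f
  proof
    assume "(\<lambda>n. smul (c n) (T (e n))) sums f"
    from bounded_linear.sums[OF S(1) this] show "(\<lambda>n. smul (c n) (e n)) sums S f"
      by (simp only: S_smul S(2))
  next
    assume "(\<lambda>n. smul (c n) (e n)) sums S f"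
    from bounded_linear.sums[OF T(1) this] show "(\<lambda>n. smul (c n) (T (e n))) sums f"
      by (simp only: T(2) S(3))
  qed
  then show ?thesis
    using e by (simp add: schauder_basis_def)
qed

section \<open>Rank-one corrections and their limit\<close>

context schauder_basis_space
begin

text \<open>The truncation acts before \<open>R\<close>, so that zeros are produced at the original
  basis vectors and not at their images under \<open>R\<close>.\<close>

definition correction :: "('x \<Rightarrow> 'k) \<Rightarrow> 'x \<Rightarrow> nat \<Rightarrow> ('x \<Rightarrow> 'x) \<Rightarrow> 'x \<Rightarrow> 'x" where
  "correction \<phi> y n R f = R f - smul (\<phi> (R (f - P n f))) y"

lemma bounded_linear_correction:
  assumes "bounded_linear \<phi>" "bounded_linear R"
  shows "bounded_linear (correction \<phi> y n R)"
  unfolding correction_def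
  using bounded_linear_comp_projection_compl[OF assms]
  by (intro bounded_linear_sub assms bounded_linear_compose[OF bounded_linear_smul_left])
    (simp add: comp_def)

lemma correction_smul:
  assumes "\<And>a x. \<phi> (smul a x) = a * \<phi> x" "\<And>a x. R (smul a x) = smul a (R x)"
  shows "correction \<phi> y n R (smul a f) = smul a (correction \<phi> y n R f)"
proof -
  have eq: "smul a f - P n (smul a f) = smul a (f - P n f)"
    by (simp add: projection_smul scale_right_diff_distrib)
  show ?thesis
    unfolding correction_def eq assms by (simp add: scale_right_diff_distrib)
qed

text \<open>Shrinking of \<open>\<phi> \<circ> R\<close> drives the \<open>onorm\<close> factor to 0
  as \<open>n\<close> grows, so a late cut-off makes the correction small even if \<open>y\<close>
  is large.\<close>

lemma norm_correction_diff:
  assumes "bounded_linear \<phi>" "bounded_linear R"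
  shows "norm (correction \<phi> y n R f - R f)
    \<le> onorm ((\<phi> \<circ> R) \<circ> (\<lambda>f. f - P n f)) * norm y * norm f"
proof -
  have "norm (\<phi> (R (f - P n f))) \<le> onorm ((\<phi> \<circ> R) \<circ> (\<lambda>f. f - P n f)) * norm f"
    using onorm[OF bounded_linear_comp_projection_compl[OF assms], of n f] by simp
  from mult_right_mono[OF this norm_ge_zero[of y]]
  have "norm (\<phi> (R (f - P n f))) * norm y
      \<le> onorm ((\<phi> \<circ> R) \<circ> (\<lambda>f. f - P n f)) * norm y * norm f"
    by (simp only: mult_ac)
  then show ?thesis
    by (simp add: correction_def norm_smul)
qed

text \<open>For \<open>n \<ge> m\<close> the projection \<open>P m\<close> annihilates
  \<open>f - P n f\<close>, so the new tail is a fixed linear combination of the tails of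
  \<open>\<psi> \<circ> R\<close> and \<open>\<phi> \<circ> R\<close>. This keeps the construction
  going after each correction.\<close>

lemma shrinking_correction:
  assumes \<phi>: "bounded_linear \<phi>" and \<psi>: "bounded_linear \<psi>" "\<And>a x. \<psi> (smul a x) = a * \<psi> x"
    and R: "bounded_linear R"
    and shr: "shrinking_wrt smul e (\<phi> \<circ> R)" "shrinking_wrt smul e (\<psi> \<circ> R)"
  shows "shrinking_wrt smul e (\<psi> \<circ> correction \<phi> y m R)"
proof -
  interpret \<psi>: bounded_linear \<psi> by fact
  define Q where "Q \<theta> n = (\<theta> \<circ> R) \<circ> (\<lambda>f. f - P n f)" for \<theta> :: "'x \<Rightarrow> 'k" and n
  have bl: "bounded_linear (Q \<theta> n)" if "bounded_linear \<theta>" for \<theta> n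
    unfolding Q_def by (intro bounded_linear_comp_projection_compl that R)
  have eq: "((\<psi> \<circ> correction \<phi> y m R) \<circ> (\<lambda>f. f - P n f)) = (\<lambda>f. Q \<psi> n f - Q \<phi> n f * \<psi> y)"
    if "n \<ge> m" for n
    using that by (auto simp: Q_def correction_def \<psi>.diff \<psi>(2) projection_diff projection_projection)
  have bound: "onorm (\<lambda>f. Q \<psi> n f - Q \<phi> n f * \<psi> y) \<le> onorm (Q \<psi> n) + onorm (Q \<phi> n) * norm (\<psi> y)"
    for n
  proof (rule onorm_bound)
    show "0 \<le> onorm (Q \<psi> n) + onorm (Q \<phi> n) * norm (\<psi> y)"
      by (intro add_nonneg_nonneg mult_nonneg_nonneg onorm_pos_le bl \<phi> \<psi>) simp
    have "norm (Q \<phi> n f) * norm (\<psi> y) \<le> onorm (Q \<phi> n) * norm f * norm (\<psi> y)" for f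
      by (intro mult_right_mono onorm bl \<phi>) simp
    then have "norm (Q \<psi> n f) + norm (Q \<phi> n f * \<psi> y)
        \<le> onorm (Q \<psi> n) * norm f + onorm (Q \<phi> n) * norm f * norm (\<psi> y)" for f
      by (intro add_mono onorm bl \<psi>) (simp add: norm_mult)
    then have "norm (Q \<psi> n f - Q \<phi> n f * \<psi> y)
        \<le> onorm (Q \<psi> n) * norm f + onorm (Q \<phi> n) * norm f * norm (\<psi> y)" for f
      by (rule order_trans[OF norm_triangle_ineq4])
    then show "norm (Q \<psi> n f - Q \<phi> n f * \<psi> y)
        \<le> (onorm (Q \<psi> n) + onorm (Q \<phi> n) * norm (\<psi> y)) * norm f" for f
      by (simp only: distrib_right mult.assoc mult.commute[of "norm (\<psi> y)"])
  qed
  have "(\<lambda>n. onorm (Q \<phi> n)) \<longlonglongrightarrow> 0" "(\<lambda>n. onorm (Q \<psi> n)) \<longlonglongrightarrow> 0"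
    using shr unfolding shrinking_wrt_def Q_def .
  then have lim: "(\<lambda>n. onorm (Q \<psi> n) + onorm (Q \<phi> n) * norm (\<psi> y)) \<longlonglongrightarrow> 0"
    by (intro tendsto_add_zero tendsto_mult_left_zero)
  show ?thesis
    unfolding shrinking_wrt_def
  proof (rule Lim_null_comparison[OF _ lim])
    have "0 \<le> onorm (\<lambda>f. Q \<psi> n f - Q \<phi> n f * \<psi> y)" for n
      by (rule onorm_pos_le[OF bounded_linear_sub[OF bl[OF \<psi>(1)]
            bounded_linear_mult_const[OF bl[OF \<phi>]]]])
    then show "\<forall>\<^sub>F n in sequentially. norm (onorm ((\<psi> \<circ> correction \<phi> y m R) \<circ> (\<lambda>f. f - P n f)))
        \<le> onorm (Q \<psi> n) + onorm (Q \<phi> n) * norm (\<psi> y)"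
      using bound by (intro eventually_sequentiallyI[of m]) (simp only: eq real_norm_def abs_of_nonneg)
  qed
qed

lemma correction_sequence:
  fixes xs :: "nat \<Rightarrow> 'x \<Rightarrow> 'k" and y :: "nat \<Rightarrow> 'x"
  assumes xs: "\<And>m. bounded_linear (xs m)" "\<And>m a x. xs m (smul a x) = a * xs m x"
    and shr: "\<And>m. shrinking_wrt smul e (xs m)" and pos: "\<And>m. d m > (0::real)"
  shows "\<exists>R N. R 0 = (\<lambda>f. f) \<and> strict_mono N \<and>
    (\<forall>m. R (Suc m) = correction (xs m) (y m) (N m) (R m)) \<and>
    (\<forall>m. bounded_linear (R m) \<and> (\<forall>a x. R m (smul a x) = smul a (R m x))) \<and>
    (\<forall>m f. norm (R (Suc m) f - R m f) \<le> d m * norm f)"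
proof -
  \<comment> \<open>A state pairs the current operator with its latest cut-off. Shrinking is kept
    for every \<open>k\<close>, as later steps treat later functionals; the clause for
    \<open>m = 0\<close> fixes the initial operator.\<close>
  define Inv where "Inv m s \<longleftrightarrow> (m = 0 \<longrightarrow> fst s = (\<lambda>f. f)) \<and> bounded_linear (fst s) \<and>
      (\<forall>a x. fst s (smul a x) = smul a (fst s x)) \<and>
      (\<forall>k. shrinking_wrt smul e (xs k \<circ> fst s))" for m :: nat and s :: "('x \<Rightarrow> 'x) \<times> nat"
  define Step where "Step m s s' \<longleftrightarrow> snd s < snd s' \<and>
      fst s' = correction (xs m) (y m) (snd s') (fst s) \<and>
      (\<forall>f. norm (fst s' f - fst s f) \<le> d m * norm f)" for m and s s' :: "('x \<Rightarrow> 'x) \<times> nat"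
  have "\<exists>S. \<forall>m. Inv m (S m) \<and> Step m (S m) (S (Suc m))"
  proof (rule dependent_nat_choice)
    show "\<exists>s. Inv 0 s"
      using shr by (intro exI[of _ "(\<lambda>f. f, 0)"]) (simp add: Inv_def comp_def)
  next
    fix s m assume "Inv m s"
    define R where "R = fst s"
    have R: "bounded_linear R" "\<And>a x. R (smul a x) = smul a (R x)"
      "\<And>k. shrinking_wrt smul e (xs k \<circ> R)"
      using \<open>Inv m s\<close> by (auto simp: Inv_def R_def)
    have "(\<lambda>n. onorm ((xs m \<circ> R) \<circ> (\<lambda>f. f - P n f)) * norm (y m)) \<longlonglongrightarrow> 0"
      using R(3)[of m] unfolding shrinking_wrt_def by (rule tendsto_mult_left_zero)
    then have "\<forall>\<^sub>F n in sequentially. onorm ((xs m \<circ> R) \<circ> (\<lambda>f. f - P n f)) * norm (y m) < d m"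
      using pos by (rule order_tendstoD)
    then have "\<exists>n>snd s. onorm ((xs m \<circ> R) \<circ> (\<lambda>f. f - P n f)) * norm (y m) < d m"
      using eventually_happens[OF eventually_conj[OF eventually_gt_at_top[of "snd s"]]] by auto
    then obtain n where n: "n > snd s"
      "onorm ((xs m \<circ> R) \<circ> (\<lambda>f. f - P n f)) * norm (y m) < d m" by blast
    define s' where "s' = (correction (xs m) (y m) n R, n)"
    have "norm (correction (xs m) (y m) n R f - R f) \<le> d m * norm f" for f
      using n(2) by (intro order_trans[OF norm_correction_diff] mult_right_mono xs R) auto
    then have "Step m s s'"
      using n(1) by (simp add: Step_def s'_def R_def)
    moreover have "Inv (Suc m) s'"
      using xs R by (simp add: Inv_def s'_def bounded_linear_correction correction_smul
          shrinking_correction)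
    ultimately show "\<exists>s'. Inv (Suc m) s' \<and> Step m s s'" by blast
  qed
  then obtain S where S: "\<And>m. Inv m (S m)" "\<And>m. Step m (S m) (S (Suc m))" by blast
  show ?thesis
  proof (intro exI conjI)
    show "fst (S 0) = (\<lambda>f. f)" using S(1)[of 0] by (simp add: Inv_def)
    \<comment> \<open>The cut-off used in step \<open>m\<close> is stored in state
      \<open>Suc m\<close>; the one in state 0 only serves as a lower bound.\<close>
    show "strict_mono (\<lambda>m. snd (S (Suc m)))"
      using S(2) by (auto simp: strict_mono_Suc_iff Step_def)
    show "\<forall>m. fst (S (Suc m)) = correction (xs m) (y m) (snd (S (Suc m))) (fst (S m))"
      "\<forall>m f. norm (fst (S (Suc m)) f - fst (S m) f) \<le> d m * norm f"
      using S(2) unfolding Step_def by blast+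
    show "\<forall>m. bounded_linear (fst (S m)) \<and> (\<forall>a x. fst (S m) (smul a x) = smul a (fst (S m) x))"
      using S(1) by (auto simp: Inv_def)
  qed
qed

text \<open>The increments are dominated by a geometric series with sum
  \<open>2 * d * norm f\<close>, so they sum to a bounded operator \<open>D\<close>, and the limit
  is the identity plus \<open>D\<close>.\<close>

lemma limit_of_corrections:
  assumes d: "d \<ge> 0" and R0: "R 0 = (\<lambda>f. f)"
    and R: "\<And>m. bounded_linear (R m)" "\<And>m a x. R m (smul a x) = smul a (R m x)"
    and diff: "\<And>m f. norm (R (Suc m) f - R m f) \<le> d * (1/2)^m * norm f"
  shows "\<exists>T. bounded_linear T \<and> (\<forall>a x. T (smul a x) = smul a (T x)) \<and>
    (\<forall>f. (\<lambda>m. R m f) \<longlonglongrightarrow> T f) \<and> onorm (\<lambda>f. f - T f) \<le> 2 * d"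
proof -
  have geo: "(\<lambda>m. d * (1/2)^m * norm f) sums (2 * d * norm f)" for f :: 'x
  proof -
    have "(\<lambda>m. (1/2::real)^m) sums 2"
      using geometric_sums[of "1/2::real"] by simp
    from sums_mult2[OF sums_mult[OF this, of d], of "norm f"] show ?thesis
      by (simp only: mult_ac)
  qed
  define D where "D f = (\<Sum>m. R (Suc m) f - R m f)" for f
  have D: "(\<lambda>m. R (Suc m) f - R m f) sums D f" for f
    unfolding D_def
    by (rule summable_sums[OF summable_comparison_test'[OF sums_summable[OF geo] diff]])
  have D_norm: "norm (D f) \<le> 2 * d * norm f" for f
    unfolding D_def sums_unique[OF geo] using diff sums_summable[OF geo]
    by (intro norm_suminf_le) auto
  have D_eqI: "D f = x" if "(\<lambda>m. R (Suc m) f - R m f) sums x" for f x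
    using D that sums_unique2 by blast
  have D_smul: "D (smul a f) = smul a (D f)" for a f
    using bounded_linear.sums[OF bounded_linear_smul_right D]
    by (intro D_eqI) (simp add: R(2) scale_right_diff_distrib)
  have D_bl: "bounded_linear D"
  proof (rule bounded_linear_intro)
    show "D (f + g) = D f + D g" for f g
      using sums_add[OF D[of f] D[of g]]
      by (intro D_eqI) (simp add: bounded_linear.linear[OF R(1)] linear_add algebra_simps)
    show "D (r *\<^sub>R f) = r *\<^sub>R D f" for r f
      using D_smul[of "of_real r"] by (simp add: smul_of_real)
    show "norm (D f) \<le> norm f * (2 * d)" for f
      using D_norm by (simp add: mult_ac)
  qed
  have lim: "(\<lambda>m. R m f) \<longlonglongrightarrow> f + D f" for f
  proof -
    have "(\<Sum>j<m. R (Suc j) f - R j f) = R m f - f" for m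
      using sum_lessThan_telescope[of "\<lambda>m. R m f" m] by (simp add: R0)
    then have "(\<lambda>m. f + (R m f - f)) \<longlonglongrightarrow> f + D f"
      using D[of f] by (intro tendsto_add tendsto_const) (simp add: sums_def)
    then show ?thesis by simp
  qed
  have "onorm (\<lambda>f. f - (f + D f)) \<le> 2 * d"
    using D_norm d by (intro onorm_bound) auto
  then show ?thesis
    using lim bounded_linear_add[OF bounded_linear_ident D_bl]
    by (intro exI[of _ "\<lambda>f. f + D f"] conjI) (simp_all only: D_smul scale_right_distrib simp_thms)
qed

end

section \<open>Construction of the perturbed basis and its zeros\<close>

theorem theorem2p4:
  fixes smul :: "'k::{real_normed_field,banach} \<Rightarrow> 'x::banach \<Rightarrow> 'x"
    and xs :: "nat \<Rightarrow> 'x \<Rightarrow> 'k"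
    and \<epsilon> :: real
    and et :: "nat \<Rightarrow> 'x"
  assumes "normed_space_over smul"
    and "separable_space (euclidean :: 'x topology)"
    and "\<And>m. xs m \<in> dual_space smul"
    and "\<epsilon> > 0"
    and "schauder_basis smul et"
    and "\<And>m. shrinking_wrt smul et (xs m)"
  shows "\<exists>(N :: nat \<Rightarrow> nat) (e :: nat \<Rightarrow> 'x).
    strict_mono N \<and> schauder_basis smul e \<and>
    (\<forall>m. \<forall>n \<ge> N m. xs m (e n) = 0) \<and>
    (\<exists>T. bounded_linear_over smul smul T \<and> (\<forall>n. T (et n) = e n) \<and>
         onorm (\<lambda>f. f - T f) < \<epsilon>)"
proof -
  interpret normed_space_over smul by fact
  interpret schauder_basis_space smul et by unfold_locales fact
  have xs: "bounded_linear (xs m)" "xs m (smul a x) = a * xs m x" for m a x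
    using assms(3)[of m]
    by (auto simp: dual_space_def bounded_linear_over_iff[OF normed_space_over_mult])
  \<comment> \<open>The total perturbation \<open>2 * d\<close> must stay below \<epsilon> for the
    norm bound and below 1 for invertibility.\<close>
  define d where "d = min \<epsilon> 1 / 4"
  have d: "d > 0" "2 * d < \<epsilon>" "2 * d < 1" using \<open>\<epsilon> > 0\<close> by (auto simp: d_def)
  have "\<exists>y. (\<forall>k<m. xs k y = 0) \<and> (xs m y = 1 \<or> (\<forall>x. (\<forall>k<m. xs k x = 0) \<longrightarrow> xs m x = 0))" for m
  proof (cases "\<exists>x. (\<forall>k<m. xs k x = 0) \<and> xs m x \<noteq> 0")
    case True
    then obtain x where "\<forall>k<m. xs k x = 0" "xs m x \<noteq> 0" by blast
    then show ?thesis by (intro exI[of _ "smul (inverse (xs m x)) x"]) (simp add: xs)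
  next
    case False
    then show ?thesis
      using bounded_linear.linear[OF xs(1)] by (intro exI[of _ 0]) (auto simp: linear_0)
  qed
  then have "\<exists>y. \<forall>m. (\<forall>k<m. xs k (y m) = 0) \<and>
      (xs m (y m) = 1 \<or> (\<forall>x. (\<forall>k<m. xs k x = 0) \<longrightarrow> xs m x = 0))"
    by (rule choice[OF allI])
  then obtain y where y_spec: "\<forall>m. (\<forall>k<m. xs k (y m) = 0) \<and>
      (xs m (y m) = 1 \<or> (\<forall>x. (\<forall>k<m. xs k x = 0) \<longrightarrow> xs m x = 0))"
    by (rule exE)
  have y: "k < m \<Longrightarrow> xs k (y m) = 0"
    "xs m (y m) = 1 \<or> (\<forall>x. (\<forall>k<m. xs k x = 0) \<longrightarrow> xs m x = 0)" for m k
    using spec[OF y_spec, of m] by (iprover+)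
  obtain R N where R0: "R 0 = (\<lambda>f. f)" and N: "strict_mono N"
    and R_Suc: "\<And>m. R (Suc m) = correction (xs m) (y m) (N m) (R m)"
    and R: "\<And>m. bounded_linear (R m)" "\<And>m a x. R m (smul a x) = smul a (R m x)"
    and R_diff: "\<And>m f. norm (R (Suc m) f - R m f) \<le> d * (1/2)^m * norm f"
  proof -
    have "d * (1/2)^m > 0" for m :: nat
      using d(1) by simp
    from correction_sequence[of xs "\<lambda>m. d * (1/2)^m" y, OF xs assms(6) this]
    show ?thesis using that by (elim exE conjE) simp
  qed
  obtain T where T: "bounded_linear T" "\<And>a x. T (smul a x) = smul a (T x)"
    and T_lim: "\<And>f. (\<lambda>m. R m f) \<longlonglongrightarrow> T f" and T_norm: "onorm (\<lambda>f. f - T f) \<le> 2 * d"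
    using limit_of_corrections[OF less_imp_le[OF d(1)] R0 R R_diff] by auto
  have xs_R_Suc: "xs k (R (Suc m) f) = xs k (R m f) - xs m (R m (f - P (N m) f)) * xs k (y m)" for k m f
    by (simp add: R_Suc correction_def xs linear_diff[OF bounded_linear.linear[OF xs(1)]])
  have xs_T: "xs k (T f) = xs k (R (Suc k) f)" for k f
  proof -
    have stable: "xs k (R (Suc k + j) f) = xs k (R (Suc k) f)" for j
      by (induction j) (simp_all add: xs_R_Suc y(1))
    have "(\<lambda>j. R (j + Suc k) f) \<longlonglongrightarrow> T f"
      using T_lim by (rule LIMSEQ_ignore_initial_segment)
    then have "(\<lambda>j. xs k (R (j + Suc k) f)) \<longlonglongrightarrow> xs k (T f)"
      by (rule bounded_linear.tendsto[OF xs(1)])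
    moreover have "xs k (R (j + Suc k) f) = xs k (R (Suc k) f)" for j
      using stable[of j] by (simp only: add.commute)
    ultimately have "(\<lambda>j. xs k (R (Suc k) f)) \<longlonglongrightarrow> xs k (T f)"
      by (simp only:)
    then show ?thesis
      by (rule LIMSEQ_unique[OF _ tendsto_const])
  qed
  have vanish: "xs m (T (et n)) = 0" if "n \<ge> N m" for m n
    using that
  \<comment> \<open>All smaller indices are needed at once when the zeros of \<open>xs m\<close> are
    inherited; strict monotonicity of \<open>N\<close> puts \<open>n\<close> beyond their cut-offs
    too.\<close>
  proof (induction m rule: less_induct)
    case (less m)
    from y(2)[of m] show ?case
    proof
      assume "xs m (y m) = 1"
      \<comment> \<open>Beyond the cut-off, \<open>P (N m)\<close> maps \<open>et n\<close> to 0, so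
        the two terms in \<open>xs_R_Suc\<close> cancel.\<close>
      then show ?thesis
        using less.prems by (simp add: xs_T xs_R_Suc projection_basis)
    next
      assume *: "\<forall>x. (\<forall>k<m. xs k x = 0) \<longrightarrow> xs m x = 0"
      have "xs k (T (et n)) = 0" if "k < m" for k
        using less strict_monoD[OF N that] that by simp
      with * show ?thesis by blast
    qed
  qed
  obtain S where "bounded_linear S" "\<And>x. S (T x) = x" "\<And>x. T (S x) = x"
    using onorm_less_1_bij[OF T(1) le_less_trans[OF T_norm d(3)]] by blast
  then have basis': "schauder_basis smul (\<lambda>n. T (et n))"
    by (rule schauder_basis_image[OF assms(5) T])
  have "bounded_linear_over smul smul T"
    using T by (simp add: bounded_linear_over_iff[OF assms(1)])
  moreover have "onorm (\<lambda>f. f - T f) < \<epsilon>"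
    using T_norm d(2) by simp
  ultimately show ?thesis
    by (intro exI[of _ N] exI[of _ "\<lambda>n. T (et n)"] conjI allI impI N basis' vanish
        exI[of _ T] refl)
qed

end
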